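(* Let $n$ be a squarefree positive integer such that, whenever $s_1,s_2$ are positive divisors of $n$ with $s_1s_2=n$, either $s_1\equiv 1$ and $s_2\equiv 5 \pmod 8$, or $s_1\equiv 5$ and $s_2\equiv 1\pmod 8$. Then the following two statements are equivalent: (i) there exist positive integers $x,y,z$ with $\gcd(nx,y)=1$ and $n^2x^4+y^4=z^2$; (ii) there exist positive divisors $d_1,d_2,d_3$ of $n$ with $d_1d_2d_3=n$, $d_2<n$ and $d_3<n$, and positive integers $x,y,z$ with $\gcd(d_2x,d_3y)=1$ and $d_1z^2=d_2^2x^4+d_3^2y^4$. *)

theory Defs
  imports "HOL-Number_Theory.Number_Theory" "HOL-Computational_Algebra.Squarefree"
begin

end

theory Submission
  imports Defs "HOL-Computational_Algebra.Nth_Powers"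
begin

text \<open>Given (i), the congruence condition forces \<open>x\<close> to be even. Applying the parametrisation of
  primitive Pythagorean triples to \<open>(y\<^sup>2)\<^sup>2 + (n x\<^sup>2)\<^sup>2 = z\<^sup>2\<close>, giving \<open>y\<^sup>2 + b\<^sup>2 = a\<^sup>2\<close> with
  \<open>2 a b = n x\<^sup>2\<close>, and then to this new triple produces \<open>s u\<^sup>2 = t\<^sub>1\<^sup>2 f\<^sup>4 + t\<^sub>2\<^sup>2 g\<^sup>4\<close> with \<open>s t\<^sub>1 t\<^sub>2 = n\<close>
  and \<open>x = 2 u f g\<close>. If \<open>t\<^sub>1\<close> or \<open>t\<^sub>2\<close> equals \<open>n\<close>, this is a solution of (i) with smaller \<open>x\<close>, so
  infinite descent yields (ii). Conversely, with \<open>P = d\<^sub>2\<^sup>2 x\<^sup>4\<close> and \<open>Q = d\<^sub>3\<^sup>2 y\<^sup>4\<close>, the identity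
  \<open>((P + Q)\<^sup>2 + 4 P Q)\<^sup>2 = (P - Q)\<^sup>4 + 16 (P + Q)\<^sup>2 P Q\<close> turns a solution of (ii) into one of (i).\<close>

section \<open>Coprime factorisations and Pythagorean triples over the naturals\<close>

lemma coprime_add_self_iff:
  fixes a b :: nat
  shows "coprime (a + b) b \<longleftrightarrow> coprime a b" "coprime (b + a) b \<longleftrightarrow> coprime a b"
    "coprime b (a + b) \<longleftrightarrow> coprime b a" "coprime b (b + a) \<longleftrightarrow> coprime b a"
  by (simp_all only: coprime_iff_gcd_eq_1 gcd_add1 gcd_add2 add.commute[of b a])
    (simp_all only: gcd.commute[of b] gcd_add1)

lemma coprime_mult_eq_square:
  fixes a b c :: nat
  assumes "coprime a b" "a * b = c ^ 2"
  obtains u v where "a = u ^ 2" "b = v ^ 2" "c = u * v"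
proof -
  have "is_nth_power 2 (a * b)"
    using assms(2) by (auto simp: is_nth_power_def)
  then have "is_nth_power 2 a" "is_nth_power 2 b"
    using is_nth_power_mult_coprime_nat_iff[OF assms(1)] by auto
  then obtain u v where uv: "a = u ^ 2" "b = v ^ 2"
    by (auto simp: is_nth_power_def)
  have "(u * v) ^ 2 = c ^ 2"
    using assms uv by (simp add: power_mult_distrib)
  then have "c = u * v"
    by simp
  with uv that show thesis
    by blast
qed

text \<open>As \<open>a\<close> and \<open>b\<close> are coprime, \<open>n\<close> splits as
  \<open>gcd a n * gcd b n\<close>. The cofactors of \<open>a\<close> and \<open>b\<close> are again
  coprime and multiply to \<open>c ^ 2\<close>, so both are squares.\<close>

lemma coprime_mult_eq_mult_square:
  fixes a b c n :: nat
  assumes "coprime a b" "a * b = n * c ^ 2" "n > 0"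
  obtains s t u v where "s * t = n" "a = s * u ^ 2" "b = t * v ^ 2" "c = u * v"
proof -
  define s t where "s = gcd a n" and "t = gcd b n"
  have cop: "coprime s t"
    using assms(1) unfolding s_def t_def by (meson coprime_divisors gcd_dvd1)
  have "s * t dvd n"
    using cop by (intro divides_mult) (auto simp: s_def t_def)
  moreover obtain e f where "n = e * f" "e dvd a" "f dvd b"
    using division_decomp[of n a b] assms(2) by auto
  then have "n dvd s * t"
    unfolding s_def t_def by (metis dvd_triv_left dvd_triv_right gcd_greatest mult_dvd_mono)
  ultimately have st: "s * t = n"
    by (rule dvd_antisym)
  obtain a' where a': "a = s * a'"
    unfolding s_def by (meson gcd_dvd1 dvdE)
  obtain b' where b': "b = t * b'"
    unfolding t_def by (meson gcd_dvd1 dvdE)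
  have "coprime a' b'"
    using assms(1) a' b' by simp
  have "(s * t) * (a' * b') = (s * t) * c ^ 2"
    using assms(2) a' b' st by (simp add: ac_simps)
  then have "a' * b' = c ^ 2"
    using st assms(3) by simp
  with \<open>coprime a' b'\<close> obtain u v where "a' = u ^ 2" "b' = v ^ 2" "c = u * v"
    by (rule coprime_mult_eq_square)
  with that st a' b' show thesis
    by blast
qed

text \<open>The numbers (c + a)/2 and (c - a)/2 are coprime with product (b/2)^2, hence squares
  \<open>p ^ 2\<close> and \<open>q ^ 2\<close>. Writing \<open>a + q ^ 2 = p ^ 2\<close> avoids
  truncated subtraction.\<close>

lemma primitive_pythagorean_triple:
  fixes a b c :: nat
  assumes eq: "a ^ 2 + b ^ 2 = c ^ 2" and "coprime a b" "odd a" "even b"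
  obtains p q where "coprime p q" "a + q ^ 2 = p ^ 2" "b = 2 * p * q" "c = p ^ 2 + q ^ 2"
proof -
  have "odd (c ^ 2)"
    using assms by (metis even_add even_power zero_less_numeral)
  then have "odd c"
    by simp
  have "a ^ 2 \<le> c ^ 2"
    using eq by linarith
  then have "a \<le> c"
    by (rule power2_le_imp_le) simp
  moreover have "even (c - a)"
    using \<open>odd c\<close> \<open>odd a\<close> by simp
  ultimately obtain k where k: "c = a + 2 * k"
    by (metis dvdE le_add_diff_inverse)
  obtain m where m: "b = 2 * m"
    using \<open>even b\<close> by (rule evenE)
  have *: "(a + k) * k = m ^ 2"
    using eq unfolding k m by (simp add: power2_eq_square algebra_simps)
  have "coprime a m"
    using assms m by simp
  then have "coprime a (m ^ 2)"
    by simp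
  then have "coprime a k"
    unfolding *[symmetric] by simp
  then have "coprime (a + k) k"
    by (simp add: coprime_add_self_iff coprime_commute)
  then obtain p q where pq: "a + k = p ^ 2" "k = q ^ 2" "m = p * q"
    using * by (rule coprime_mult_eq_square)
  have "coprime (p ^ 2) (q ^ 2)"
    using \<open>coprime (a + k) k\<close> by (simp only: pq(1,2)[symmetric])
  then have "coprime p q"
    by simp
  with that pq k m show thesis
    by simp
qed

section \<open>Obstructions modulo 8\<close>

lemma odd_square_mod_8:
  fixes u :: nat
  assumes "odd u"
  shows "u ^ 2 mod 8 = 1"
  using assms square_mod_8_eq_1_iff[of u] by (simp add: cong_def)

text \<open>The left side is 2 modulo 8. Since it is even and \<open>d\<close> is odd,
  \<open>c\<close> would be even, making the right side divisible by 4.\<close>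

lemma sum_odd_squares_neq:
  fixes a b c d :: nat
  assumes "odd a" "odd b" "odd d"
  shows "a ^ 2 + b ^ 2 \<noteq> d * c ^ 2"
proof
  assume eq: "a ^ 2 + b ^ 2 = d * c ^ 2"
  have "(a ^ 2 + b ^ 2) mod 8 = (1 + 1) mod 8"
    using assms odd_square_mod_8 by (metis mod_add_eq)
  then have *: "(d * c ^ 2) mod 8 = 2"
    by (simp add: eq)
  have "even (d * c ^ 2)"
    using assms by (simp flip: eq)
  then obtain k where "c = 2 * k"
    using \<open>odd d\<close> by auto
  then have "d * c ^ 2 = 4 * (d * k ^ 2)"
    by (simp add: power2_eq_square)
  with * show False
    by presburger
qed

text \<open>If \<open>x\<close> were odd, factoring \<open>n x\<^sup>2 = (p - q) (p + q)\<close> would give \<open>2 p = s u\<^sup>2 + t v\<^sup>2 \<equiv> 6\<close>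
  modulo 8, whereas \<open>p\<close> is an odd square because \<open>p \<cdot> 2 q = y\<^sup>2\<close>.\<close>

lemma quartic_solution_even:
  fixes n x y z :: nat
  assumes n: "n > 0" "odd n"
    and cond: "\<forall>s t. s * t = n \<longrightarrow> (s + t) mod 8 = 6"
    and eq: "n ^ 2 * x ^ 4 + y ^ 4 = z ^ 2" and cop: "coprime (n * x) y"
  shows "even x"
proof (rule ccontr)
  assume "odd x"
  have eq': "(n * x ^ 2) ^ 2 + (y ^ 2) ^ 2 = z ^ 2"
    using eq by (simp add: power_mult_distrib flip: power_mult)
  have "even y"
    using sum_odd_squares_neq[of "n * x ^ 2" "y ^ 2" 1 z] eq' \<open>odd n\<close> \<open>odd x\<close> by auto
  have "coprime (n * x ^ 2) (y ^ 2)" "odd (n * x ^ 2)" "even (y ^ 2)"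
    using cop \<open>odd n\<close> \<open>odd x\<close> \<open>even y\<close> by auto
  with eq' obtain p q where pq: "coprime p q" "n * x ^ 2 + q ^ 2 = p ^ 2" "y ^ 2 = 2 * p * q"
    by (rule primitive_pythagorean_triple)
  have "q ^ 2 \<le> p ^ 2"
    using pq(2) by linarith
  then have "q \<le> p"
    by (rule power2_le_imp_le) simp
  then obtain r where r: "p = q + r"
    using le_Suc_ex by blast
  have rq: "r * (2 * q + r) = n * x ^ 2"
    using pq(2) unfolding r by (simp add: power2_eq_square algebra_simps)
  then have "odd r"
    using \<open>odd (n * x ^ 2)\<close> by (metis dvd_mult2)
  have "coprime r q"
    using pq(1) unfolding r by (simp add: coprime_add_self_iff coprime_commute)
  then have "coprime r (2 * q)"
    using \<open>odd r\<close> by simp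
  then have "coprime r (2 * q + r)"
    by (simp add: coprime_add_self_iff coprime_commute)
  then obtain s t u v where st: "s * t = n" "r = s * u ^ 2" "2 * q + r = t * v ^ 2" "x = u * v"
    using rq \<open>n > 0\<close> by (rule coprime_mult_eq_mult_square)
  have "odd u" "odd v"
    using \<open>odd x\<close> st(4) by auto
  then have "u ^ 2 mod 8 = 1" "v ^ 2 mod 8 = 1"
    by (simp_all add: odd_square_mod_8)
  then have "(s * u ^ 2 + t * v ^ 2) mod 8 = (s + t) mod 8"
    by (metis mod_add_eq mod_mult_right_eq mult.right_neutral)
  moreover have "2 * p = s * u ^ 2 + t * v ^ 2"
    using st r by linarith
  ultimately have p: "2 * p mod 8 = 6"
    using cond st(1) by simp
  then have "odd p"
    by presburger
  then have "coprime p (2 * q)"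
    using pq(1) by simp
  moreover have "p * (2 * q) = y ^ 2"
    using pq(3) by simp
  ultimately obtain w where "p = w ^ 2"
    by (rule coprime_mult_eq_square)
  moreover from this have "odd w"
    using \<open>odd p\<close> by simp
  ultimately have "p mod 8 = 1"
    using odd_square_mod_8 by simp
  with p show False
    by presburger
qed

section \<open>Descent on the quartic, and its converse\<close>

lemma quartic_two_descent:
  fixes n x y z :: nat
  assumes "n > 0" and "even x"
    and eq: "n ^ 2 * x ^ 4 + y ^ 4 = z ^ 2" and cop: "coprime (n * x) y"
  obtains s t1 t2 u f g where "s * t1 * t2 = n" "s * u ^ 2 = t1 ^ 2 * f ^ 4 + t2 ^ 2 * g ^ 4"
    "coprime (t1 * f) (t2 * g)" "x = 2 * u * f * g"
proof -
  obtain x' where x': "x = 2 * x'"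
    using \<open>even x\<close> by (rule evenE)
  have "odd y"
    using cop \<open>even x\<close> by auto
  have "(y ^ 2) ^ 2 + (n * x ^ 2) ^ 2 = z ^ 2"
    using eq by (simp add: power_mult_distrib flip: power_mult)
  moreover have "coprime (y ^ 2) (n * x ^ 2)" "odd (y ^ 2)" "even (n * x ^ 2)"
    using cop \<open>even x\<close> \<open>odd y\<close> by (auto simp: coprime_commute)
  ultimately obtain a b where ab: "coprime a b" "y ^ 2 + b ^ 2 = a ^ 2" "n * x ^ 2 = 2 * a * b"
    by (rule primitive_pythagorean_triple)
  have "even b"
    using sum_odd_squares_neq[of y b 1 a] ab(2) \<open>odd y\<close> by auto
  then obtain b' where b': "b = 2 * b'"
    by (rule evenE)
  have "a * b' = n * x' ^ 2"
    using ab(3) unfolding x' b' by (simp add: power_mult_distrib)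
  moreover have "coprime a b'"
    using ab(1) b' by simp
  \<comment> \<open>First splitting of \<open>n\<close>: \<open>s\<close> goes with the hypotenuse
    \<open>a\<close>, \<open>t\<close> with the leg \<open>b\<close>.\<close>
  ultimately obtain s t u v where st: "s * t = n" "a = s * u ^ 2" "b' = t * v ^ 2" "x' = u * v"
    using \<open>n > 0\<close> by (metis coprime_mult_eq_mult_square)
  have "coprime (b ^ 2) (a ^ 2)"
    using ab(1) by (simp add: coprime_commute)
  then have "coprime (y ^ 2) (b ^ 2)"
    unfolding ab(2)[symmetric] by (simp add: coprime_add_self_iff coprime_commute)
  then have "coprime y b"
    by simp
  with ab(2) obtain p q where pq: "coprime p q" "b = 2 * p * q" "a = p ^ 2 + q ^ 2"
    using \<open>odd y\<close> \<open>even b\<close> by (rule primitive_pythagorean_triple)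
  have "p * q = t * v ^ 2"
    using pq(2) b' st(3) by simp
  moreover have "t > 0"
    using st(1) \<open>n > 0\<close> by (cases t) auto
  \<comment> \<open>Second splitting, now of \<open>t\<close>. Substituting \<open>p\<close> and
    \<open>q\<close> into \<open>a = p ^ 2 + q ^ 2\<close> yields the required equation.\<close>
  ultimately obtain t1 t2 f g where t: "t1 * t2 = t" "p = t1 * f ^ 2" "q = t2 * g ^ 2" "v = f * g"
    using pq(1) coprime_mult_eq_mult_square by metis
  show thesis
  proof
    show "s * t1 * t2 = n"
      using st(1) t(1) by (simp add: mult.assoc)
    show "s * u ^ 2 = t1 ^ 2 * f ^ 4 + t2 ^ 2 * g ^ 4"
      using pq(3) st(2) t by (simp add: power_mult_distrib flip: power_mult)
    show "coprime (t1 * f) (t2 * g)"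
      using pq(1) t by simp
    show "x = 2 * u * f * g"
      using x' st(4) t(4) by simp
  qed
qed

text \<open>The witnesses are 2xyz, |P - Q| and (P + Q)^2 + 4PQ. Since P + Q = d1 z^2, the term 16
  (P + Q)^2 PQ equals (d1 d2 d3)^2 (2xyz)^4.\<close>

lemma quartic_two_covering:
  fixes d1 d2 d3 x y z :: nat
  assumes odd: "odd d1" "odd d2" "odd d3"
    and pos: "x > 0" "y > 0" "z > 0"
    and cop: "coprime (d2 * x) (d3 * y)"
    and eq: "d1 * z ^ 2 = d2 ^ 2 * x ^ 4 + d3 ^ 2 * y ^ 4"
  shows "\<exists>X Y Z :: nat. X > 0 \<and> Y > 0 \<and> Z > 0 \<and> coprime (d1 * d2 * d3 * X) Y \<and>
    (d1 * d2 * d3) ^ 2 * X ^ 4 + Y ^ 4 = Z ^ 2"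
proof -
  define P Q where "P = d2 ^ 2 * x ^ 4" and "Q = d3 ^ 2 * y ^ 4"
  \<comment> \<open>The difference is formed in \<open>int\<close>, as it may have either
    sign.\<close>
  define A where "A = \<bar>int P - int Q\<bar>"
  define Y where "Y = nat A"
  have PQ: "coprime P Q"
    using cop unfolding P_def Q_def by simp
  have eq': "d1 * z ^ 2 = P + Q"
    using eq by (simp add: P_def Q_def)
  \<comment> \<open>An even sum of coprime numbers has both terms odd, so \<open>d1 * z ^ 2\<close>
    would be a sum of two odd squares. Oddness of the sum then makes \<open>Y\<close> nonzero and
    odd.\<close>
  have "odd (P + Q)"
  proof
    assume even: "even (P + Q)"
    have "odd P" "odd Q"
      using even PQ by (meson coprime_common_divisor_nat even_add odd_one dvd_refl coprime_common_divisor)+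
    then have "odd (d2 * x ^ 2)" "odd (d3 * y ^ 2)"
      by (auto simp: P_def Q_def)
    from sum_odd_squares_neq[OF this odd(1), of z] eq show False
      by (simp add: power_mult_distrib flip: power_mult)
  qed
  then have "P \<noteq> Q"
    by auto
  then have "Y > 0"
    by (simp add: Y_def A_def)
  have Y: "P = Q + Y \<or> Q = P + Y"
    by (auto simp: Y_def A_def)
  have "odd Y"
    using Y \<open>odd (P + Q)\<close> by auto
  have YP: "coprime Y P" and YQ: "coprime Y Q"
    using Y PQ by (auto simp: coprime_add_self_iff coprime_commute)
  have "coprime Y (P + Q)"
  proof -
    have "P + Q = 2 * Q + Y \<or> P + Q = 2 * P + Y"
      using Y by auto
    moreover have "coprime Y (2 * Q)" "coprime Y (2 * P)"
      using YP YQ \<open>odd Y\<close> by auto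
    ultimately show ?thesis
      by (metis coprime_add_self_iff(3))
  qed
  then have "coprime Y (d1 * z ^ 2)"
    by (simp add: eq')
  then have cop': "coprime (d1 * d2 * d3 * (2 * x * y * z)) Y"
    using YP YQ \<open>odd Y\<close> pos by (auto simp: P_def Q_def coprime_commute)
  have sq: "(P + Q) ^ 2 = Y ^ 2 + 4 * P * Q"
    using Y by (auto simp: power2_eq_square algebra_simps)
  have "((P + Q) ^ 2 + 4 * P * Q) ^ 2 = Y ^ 4 + 16 * (P + Q) ^ 2 * P * Q"
    unfolding sq by (simp add: power2_eq_square power4_eq_xxxx algebra_simps)
  also have "16 * (P + Q) ^ 2 * P * Q = (d1 * d2 * d3) ^ 2 * (2 * x * y * z) ^ 4"
    unfolding eq'[symmetric] by (simp add: P_def Q_def power_mult_distrib flip: power_mult)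
  finally have "(d1 * d2 * d3) ^ 2 * (2 * x * y * z) ^ 4 + Y ^ 4 = ((P + Q) ^ 2 + 4 * P * Q) ^ 2"
    by simp
  moreover have "2 * x * y * z > 0" "(P + Q) ^ 2 + 4 * P * Q > 0"
    using pos odd_pos[OF \<open>odd (P + Q)\<close>] by simp_all
  ultimately show ?thesis
    using cop' \<open>Y > 0\<close> by blast
qed

text \<open>Strong induction on \<open>x\<close>: each failure of \<open>d2 < n\<close> or
  \<open>d3 < n\<close> is itself a solution of the original quartic, with \<open>f\<close> or
  \<open>g\<close> in place of \<open>x\<close>.\<close>

lemma quartic_descent:
  fixes n x y z :: nat
  assumes n: "n > 0" "odd n"
    and cond: "\<forall>s t. s * t = n \<longrightarrow> (s + t) mod 8 = 6"
    and "x > 0" "y > 0" "coprime (n * x) y" "n ^ 2 * x ^ 4 + y ^ 4 = z ^ 2"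
  shows "\<exists>d1 d2 d3 x y z :: nat. d1 * d2 * d3 = n \<and> d2 < n \<and> d3 < n \<and>
    x > 0 \<and> y > 0 \<and> z > 0 \<and> coprime (d2 * x) (d3 * y) \<and>
    d1 * z ^ 2 = d2 ^ 2 * x ^ 4 + d3 ^ 2 * y ^ 4"
  using assms(4-)
proof (induction x arbitrary: y z rule: less_induct)
  case (less x)
  have "even x"
    using n cond less.prems(4,3) by (rule quartic_solution_even)
  with n(1) less.prems obtain s t1 t2 u f g where
    st: "s * t1 * t2 = n" and eq: "s * u ^ 2 = t1 ^ 2 * f ^ 4 + t2 ^ 2 * g ^ 4" and
    cop: "coprime (t1 * f) (t2 * g)" and x: "x = 2 * u * f * g"
    by (metis quartic_two_descent)
  have pos: "u > 0" "f > 0" "g > 0"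
    using x \<open>x > 0\<close> by auto
  have "u * g > 0" "u * f > 0"
    using pos by simp_all
  \<comment> \<open>The factor 2 in \<open>x = 2 * u * f * g\<close>, due to \<open>x\<close> being
    even, makes the descent strict even if \<open>u\<close>, \<open>f\<close> and \<open>g\<close>
    are all 1.\<close>
  then have "1 < 2 * (u * g)" "1 < 2 * (u * f)"
    by linarith+
  then have "f < f * (2 * (u * g))" "g < g * (2 * (u * f))"
    using pos by simp_all
  then have "f < x" "g < x"
    unfolding x by (simp_all only: ac_simps)
  have "t1 dvd n" "t2 dvd n"
    using st by auto
  then have le: "t1 \<le> n" "t2 \<le> n"
    using n by (auto intro: dvd_imp_le)
  show ?case
  proof (cases "t1 < n \<and> t2 < n")
    case True
    then show ?thesis
      using st eq cop pos by blast
  next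
    case False
    then consider "t1 = n" | "t2 = n"
      using le by linarith
    then show ?thesis
    proof cases
      \<comment> \<open>The equation becomes u^2 = n^2 f^4 + g^4; the other case exchanges
        \<open>f\<close> and \<open>g\<close>.\<close>
      case 1
      then have "s = 1" "t2 = 1"
        using st n by auto
      with 1 eq cop show ?thesis
        by (intro less.IH[OF \<open>f < x\<close>, of g u]) (use pos in \<open>auto simp: coprime_commute\<close>)
    next
      case 2
      then have "s = 1" "t1 = 1"
        using st n by auto
      with 2 eq cop show ?thesis
        by (intro less.IH[OF \<open>g < x\<close>, of f u]) (use pos in \<open>auto simp: coprime_commute\<close>)
    qed
  qed
qed

theorem theorem2:
  fixes n :: nat
  assumes "n > 0"
    and "squarefree n"
    and "\<And>s1 s2 :: nat. \<lbrakk>s1 > 0; s2 > 0; s1 dvd n; s2 dvd n; s1 * s2 = n\<rbrakk> \<Longrightarrow>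
           ([s1 = 1] (mod 8) \<and> [s2 = 5] (mod 8)) \<or> ([s1 = 5] (mod 8) \<and> [s2 = 1] (mod 8))"
  shows "(\<exists>x y z :: nat. x > 0 \<and> y > 0 \<and> z > 0 \<and> gcd (n * x) y = 1 \<and>
            n ^ 2 * x ^ 4 + y ^ 4 = z ^ 2)
     \<longleftrightarrow>
         (\<exists>d1 d2 d3 :: nat. d1 > 0 \<and> d2 > 0 \<and> d3 > 0 \<and>
            d1 dvd n \<and> d2 dvd n \<and> d3 dvd n \<and>
            d1 * d2 * d3 = n \<and> d2 < n \<and> d3 < n \<and>
            (\<exists>x y z :: nat. x > 0 \<and> y > 0 \<and> z > 0 \<and> gcd (d2 * x) (d3 * y) = 1 \<and>
               d1 * z ^ 2 = d2 ^ 2 * x ^ 4 + d3 ^ 2 * y ^ 4))"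
    (is "?L \<longleftrightarrow> ?R")
proof -
  \<comment> \<open>The two residue patterns share the sum 1 + 5, so the condition enters the
    descent in this symmetric form.\<close>
  have cond: "\<forall>s t. s * t = n \<longrightarrow> (s + t) mod 8 = 6"
  proof (intro allI impI)
    fix s t
    assume that: "s * t = n"
    have "s > 0" "t > 0" "s dvd n" "t dvd n"
      using that assms(1) by auto
    from assms(3)[OF this that] have "s mod 8 = 1 \<and> t mod 8 = 5 \<or> s mod 8 = 5 \<and> t mod 8 = 1"
      by (simp add: cong_def)
    then show "(s + t) mod 8 = 6"
      by (subst mod_add_eq[symmetric]) auto
  qed
  \<comment> \<open>The trivial factorisation 1 * n already fixes \<open>n\<close> modulo 8.\<close>
  have "(1 + n) mod 8 = 6"
    using cond by (metis mult_1)
  then have "odd n"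
    by presburger
  show ?thesis
  proof
    assume ?L
    then obtain x y z where xyz: "x > 0" "y > 0" "gcd (n * x) y = 1"
      "n ^ 2 * x ^ 4 + y ^ 4 = z ^ 2"
      by (elim exE conjE)
    have "coprime (n * x) y"
      using xyz(3) by (simp only: coprime_iff_gcd_eq_1)
    from quartic_descent[OF assms(1) \<open>odd n\<close> cond xyz(1,2) this xyz(4)]
    obtain d1 d2 d3 u v w where *: "d1 * d2 * d3 = n" "d2 < n" "d3 < n"
      "u > 0" "v > 0" "w > 0" "coprime (d2 * u) (d3 * v)"
      "d1 * w ^ 2 = d2 ^ 2 * u ^ 4 + d3 ^ 2 * v ^ 4"
      by (elim exE conjE)
    have "gcd (d2 * u) (d3 * v) = 1"
      using *(7) by (simp only: coprime_iff_gcd_eq_1)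
    moreover have "d1 > 0" "d2 > 0" "d3 > 0" "d1 dvd n" "d2 dvd n" "d3 dvd n"
      using *(1) assms(1) by auto
    ultimately show ?R
      using *(1-6,8) by (intro exI conjI)
  next
    assume ?R
    then obtain d1 d2 d3 x y z where *: "d1 * d2 * d3 = n"
      "x > 0" "y > 0" "z > 0" "gcd (d2 * x) (d3 * y) = 1"
      "d1 * z ^ 2 = d2 ^ 2 * x ^ 4 + d3 ^ 2 * y ^ 4"
      by (elim exE conjE)
    have "coprime (d2 * x) (d3 * y)"
      using *(5) by (simp only: coprime_iff_gcd_eq_1)
    moreover have "odd d1" "odd d2" "odd d3"
      using *(1) \<open>odd n\<close> by auto
    ultimately show ?L
      using quartic_two_covering[of d1 d2 d3 x y z] *
      by (simp only: coprime_iff_gcd_eq_1 simp_thms)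
  qed
qed

end
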